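(* Let $f:\mathbb{N}\to\mathbb{R}$ be a nonnegative multiplicative function with $f(1)=1$, and let $k\ge2$ be a fixed integer. If for every prime $p$ and all integers $a,b\ge0$ one has $\big(f(p^{a+b})\big)^k\le f(p^{ka})f(p^{kb})$ (resp. $\big(f(p^{a+b})\big)^k\ge f(p^{ka})f(p^{kb})$), then $f$ is $k$-sub-multiplicative (resp. $k$-super-multiplicative).
   Context: $\mathbb{N}=\{1,2,3,\dots\}$. $f$ is multiplicative if $f(mn)=f(m)f(n)$ whenever $\gcd(m,n)=1$. $f$ is $k$-sub-multiplicative if $\big(f(mn)\big)^k\le f(m^k)f(n^k)$ for all $m,n\ge1$, and $k$-super-multiplicative if $\big(f(mn)\big)^k\ge f(m^k)f(n^k)$ for all $m,n\ge1$. *)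

theory Defs
  imports Complex_Main "HOL-Computational_Algebra.Primes"
begin

text \<open>
  An arithmetic function on the positive integers is represented by a function of type
  \<^typ>\<open>nat \<Rightarrow> real\<close> whose value at \<open>0\<close> is irrelevant: all conditions
  below only concern positive arguments.
\<close>

definition multiplicative :: "(nat \<Rightarrow> real) \<Rightarrow> bool" where
  "multiplicative f \<longleftrightarrow>
     (\<forall>m\<ge>1. \<forall>n\<ge>1. gcd m n = 1 \<longrightarrow> f (m * n) = f m * f n)"

definition sub_multiplicative :: "nat \<Rightarrow> (nat \<Rightarrow> real) \<Rightarrow> bool" where
  "sub_multiplicative k f \<longleftrightarrow>
     (\<forall>m\<ge>1. \<forall>n\<ge>1. (f (m * n)) ^ k \<le> f (m ^ k) * f (n ^ k))"

definition super_multiplicative :: "nat \<Rightarrow> (nat \<Rightarrow> real) \<Rightarrow> bool" where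
  "super_multiplicative k f \<longleftrightarrow>
     (\<forall>m\<ge>1. \<forall>n\<ge>1. (f (m * n)) ^ k \<ge> f (m ^ k) * f (n ^ k))"

end

theory Submission
  imports Defs
begin

lemma multiplicative_prime_power_split:
  assumes "multiplicative f" "prime p" "\<not> p dvd m" "m \<ge> 1"
  shows "f (p ^ a * m) = f (p ^ a) * f m"
proof -
  have "coprime (p ^ a) m"
    using assms(2,3) by (simp add: prime_imp_coprime)
  then have "gcd (p ^ a) m = 1"
    by simp
  moreover have "p ^ a \<ge> 1"
    using prime_gt_0_nat[OF assms(2)] by simp
  ultimately show ?thesis
    using assms(1,4) by (simp add: multiplicative_def)
qed

text \<open>
  The relation \<open>R\<close> stands for \<open>\<le>\<close> or \<open>\<ge>\<close>: all that matters is that it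
  relates \<open>1\<close> to itself and is compatible with products of nonnegative reals. The induction
  splits off from both arguments the full powers of one prime dividing their product.
\<close>

lemma multiplicative_relation_from_prime_powers:
  fixes R :: "real \<Rightarrow> real \<Rightarrow> bool"
  assumes nonneg: "\<And>n. n \<ge> 1 \<Longrightarrow> f n \<ge> 0"
    and mult: "multiplicative f"
    and one: "f 1 = 1"
    and R_one: "R 1 1"
    and R_mult: "\<And>x y u v. \<lbrakk>x \<ge> 0; y \<ge> 0; u \<ge> 0; v \<ge> 0; R x y; R u v\<rbrakk> \<Longrightarrow> R (x * u) (y * v)"
    and R_prime: "\<And>p a b. prime p \<Longrightarrow> R (f (p ^ (a + b)) ^ k) (f (p ^ (k * a)) * f (p ^ (k * b)))"
    and "m \<ge> 1" "n \<ge> 1"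
  shows "R (f (m * n) ^ k) (f (m ^ k) * f (n ^ k))"
  using \<open>m \<ge> 1\<close> \<open>n \<ge> 1\<close>
\<comment> \<open>The arguments must vary along with their product: the induction hypothesis is
  applied to the cofactors \<open>x\<close> and \<open>y\<close> left after one prime is
  removed.\<close>
proof (induction "m * n" arbitrary: m n rule: less_induct)
  case less
  show ?case
  proof (cases "m * n = 1")
    case True
    then show ?thesis
      using one R_one by simp
  next
    case False
    then obtain p where p: "prime p" "p dvd m * n"
      using prime_factor_nat by blast
    have not_unit: "\<not> is_unit p"
      using p(1) not_prime_unit by blast
    \<comment> \<open>The exponent \<open>a\<close> may be 0: \<open>p\<close> is only known to
      divide the product, so it may fail to divide one of the two arguments.\<close>
    have split: "\<exists>a x. r = p ^ a * x \<and> \<not> p dvd x \<and> x \<ge> 1" if "r \<ge> 1" for r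
    proof -
      have "r \<noteq> 0"
        using \<open>r \<ge> 1\<close> by simp
      then obtain x where x: "r = p ^ multiplicity p r * x" "\<not> p dvd x"
        using multiplicity_decompose'[of r p] not_unit by blast
      with \<open>r \<ge> 1\<close> have "x \<ge> 1"
        by (cases "x = 0") auto
      with x show ?thesis
        by blast
    qed
    obtain a x where x: "m = p ^ a * x" "\<not> p dvd x" "x \<ge> 1"
      using split less.prems(1) by blast
    obtain b y where y: "n = p ^ b * y" "\<not> p dvd y" "y \<ge> 1"
      using split less.prems(2) by blast
    have xy: "\<not> p dvd x * y" "x * y \<ge> 1"
      using p(1) x y by (auto simp: prime_dvd_mult_iff)
    have "\<not> p dvd x ^ k" "\<not> p dvd y ^ k"
      using p(1) x(2) y(2) prime_dvd_power by blast+
    note coprime_parts = this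
    have mn: "m * n = p ^ (a + b) * (x * y)"
      using x(1) y(1) by (simp add: power_add)
    \<comment> \<open>Were both exponents 0, the product would be \<open>x * y\<close>, which
      \<open>p\<close> does not divide. So at least one factor \<open>p\<close> is removed and the
      product strictly decreases.\<close>
    have "a + b \<noteq> 0"
      using mn p(2) xy(1) by (cases "a + b") simp_all
    then have "p ^ (a + b) > 1"
      using prime_gt_1_nat[OF p(1)] by (intro one_less_power) auto
    then have "x * y < m * n"
      using mn xy(2) by simp
    then have IH: "R (f (x * y) ^ k) (f (x ^ k) * f (y ^ k))"
      using less.hyps x(3) y(3) by blast
    have pos: "p ^ c \<ge> 1" for c
      using prime_gt_0_nat[OF p(1)] by simp
    \<comment> \<open>The cofactors \<open>x\<close> and \<open>y\<close> may share primes, so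
      \<open>f (x * y)\<close> is kept whole; multiplicativity only separates a power of
      \<open>p\<close> from a number that \<open>p\<close> does not divide.\<close>
    have lhs: "f (m * n) ^ k = f (p ^ (a + b)) ^ k * f (x * y) ^ k"
      unfolding mn multiplicative_prime_power_split[OF mult p(1) xy]
      by (rule power_mult_distrib)
    have "f (m ^ k) = f (p ^ (k * a)) * f (x ^ k)"
      unfolding x(1) power_mult_distrib power_mult[symmetric] mult.commute[of a k]
      using multiplicative_prime_power_split[OF mult p(1) coprime_parts(1)] x(3) by simp
    moreover have "f (n ^ k) = f (p ^ (k * b)) * f (y ^ k)"
      unfolding y(1) power_mult_distrib power_mult[symmetric] mult.commute[of b k]
      using multiplicative_prime_power_split[OF mult p(1) coprime_parts(2)] y(3) by simp
    \<comment> \<open>The grouping matches \<open>lhs\<close>: the \<open>p\<close>-parts are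
      compared by \<open>R_prime\<close>, the cofactor parts by \<open>IH\<close>, and
      \<open>R_mult\<close> multiplies the two.\<close>
    ultimately have rhs: "f (m ^ k) * f (n ^ k) =
        (f (p ^ (k * a)) * f (p ^ (k * b))) * (f (x ^ k) * f (y ^ k))"
      by simp
    \<comment> \<open>\<open>R_mult\<close> requires nonnegative factors, and \<open>nonneg\<close>
      covers only positive arguments of \<open>f\<close>.\<close>
    have "x ^ k \<ge> 1" "y ^ k \<ge> 1"
      using x(3) y(3) by simp_all
    then show ?thesis
      unfolding lhs rhs
      by (intro R_mult R_prime IH p(1) mult_nonneg_nonneg zero_le_power nonneg pos xy(2))
  qed
qed

theorem theorem7:
  fixes f :: "nat \<Rightarrow> real" and k :: nat
  assumes nonneg: "\<forall>n\<ge>1. f n \<ge> 0"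
    and mult: "multiplicative f"
    and one: "f 1 = 1"
    and k: "k \<ge> 2"
  shows "((\<forall>p a b. prime p \<longrightarrow> (f (p ^ (a + b))) ^ k \<le> f (p ^ (k * a)) * f (p ^ (k * b)))
            \<longrightarrow> sub_multiplicative k f) \<and>
         ((\<forall>p a b. prime p \<longrightarrow> (f (p ^ (a + b))) ^ k \<ge> f (p ^ (k * a)) * f (p ^ (k * b)))
            \<longrightarrow> super_multiplicative k f)"
proof (intro conjI impI)
  assume prime_powers: "\<forall>p a b. prime p \<longrightarrow> (f (p ^ (a + b))) ^ k \<le> f (p ^ (k * a)) * f (p ^ (k * b))"
  have "f (m * n) ^ k \<le> f (m ^ k) * f (n ^ k)" if "m \<ge> 1" "n \<ge> 1" for m n
    by (rule multiplicative_relation_from_prime_powers[where R = "(\<le>)" and f = f])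
      (use nonneg mult one prime_powers that in \<open>simp_all add: mult_mono\<close>)
  then show "sub_multiplicative k f"
    unfolding sub_multiplicative_def by blast
next
  assume prime_powers: "\<forall>p a b. prime p \<longrightarrow> (f (p ^ (a + b))) ^ k \<ge> f (p ^ (k * a)) * f (p ^ (k * b))"
  have "f (m * n) ^ k \<ge> f (m ^ k) * f (n ^ k)" if "m \<ge> 1" "n \<ge> 1" for m n
    \<comment> \<open>Here \<open>R x y\<close> reads \<open>y \<le> x\<close>, so
      \<open>mult_mono\<close> acts with the sides exchanged. Nonnegativity of all four reals in
      \<open>R_mult\<close> serves both directions.\<close>
    by (rule multiplicative_relation_from_prime_powers[where R = "(\<ge>)" and f = f])
      (use nonneg mult one prime_powers that in \<open>simp_all add: mult_mono\<close>)
  then show "super_multiplicative k f"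
    unfolding super_multiplicative_def by blast
qed

end
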